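(* Let $G$ be a group. Let $\mathrm{Cos}_U(G)$ be the set of all double coset digraphs $\mathrm{Cos}(G,K,S)$ with $1<K\le G$, $S\subset G$, $K\cap S=\emptyset$, $S=KSK$, such that $K$ is maximal among the subgroups $L\le G$ with $LSL=S$. Define $\gamma_U\colon \mathrm{Cos}_U(G)\to\mathrm{Reducible}(G)$ by $\gamma_U(\mathrm{Cos}(G,K,S))=\mathrm{Cay}(G,S)$. Then $\gamma_U$ is a bijection.
   Context: For $K\le G$ and $S\subset G$ with $S\cap K=\emptyset$ and $KSK=S$, the double coset digraph $\mathrm{Cos}(G,K,S)$ has as vertices the left cosets of $K$ in $G$ and arc set $\{(gK,gsK):g\in G,s\in S\}$; $K$ is not required to be core-free. For $S\subset G$ with $1\notin S$, the Cayley digraph $\mathrm{Cay}(G,S)$ has vertex set $G$ and arc set $\{(g,gs):g\in G,s\in S\}$. The wreath product $\Gamma_1\wr\Gamma_2$ of digraphs has vertex set $V(\Gamma_1)\times V(\Gamma_2)$ and arc set $\{((u,v),(u,v')):u\in V(\Gamma_1),(v,v')\in A(\Gamma_2)\}\cup\{((u,v),(u',v')):(u,u')\in A(\Gamma_1),v,v'\in V(\Gamma_2)\}$. $\bar K_t$ is the digraph with $t$ vertices and no arcs. $\mathrm{Reducible}(G)$ is the set of all Cayley digraphs $\mathrm{Cay}(G,S)$ of $G$ such that $\mathrm{Cay}(G,S)\cong\Gamma\wr\bar K_t$ for some digraph $\Gamma$ and some $t\ge 2$. *)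

theory Defs
  imports
    "HOL-Algebra.Algebra"
    "Graph_Theory.Pair_Digraph"
    "Graph_Theory.Digraph_Isomorphism"
begin

text \<open>A digraph is a vertex set with a set of ordered pairs as arcs (\<open>'a pair_pre_digraph\<close>).
  Two digraphs are equal iff their vertex and arc sets are; isomorphism is
  \<open>digraph_iso\<close>, which the following lemma identifies with the usual notion for such digraphs.\<close>

lemma digraph_iso_with_proj_iff:
  assumes "pair_wf_digraph A"
  shows "digraph_iso (with_proj A) (with_proj B) \<longleftrightarrow>
    (\<exists>f. bij_betw f (pverts A) (pverts B) \<and> parcs B = (\<lambda>(u, v). (f u, f v)) ` parcs A)"
proof
  interpret pair_wf_digraph A by (rule assms)
  assume "digraph_iso (with_proj A) (with_proj B)"
  then obtain h where h: "pre_digraph.digraph_isomorphism (with_proj A) h"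
    and B: "with_proj B = app_iso h (with_proj A)"
    by (auto simp: digraph_iso_def)
  have B': "pverts B = iso_verts h ` pverts A" "parcs B = iso_arcs h ` parcs A"
      "fst = iso_tail h" "snd = iso_head h"
    using B by (simp_all add: with_proj_def app_iso_def)
  have inj: "inj_on (iso_verts h) (pverts A)"
    using h by (simp add: pre_digraph.digraph_isomorphism_def)
  have "iso_arcs h a = (iso_verts h (fst a), iso_verts h (snd a))" if "a \<in> parcs A" for a
    using h that by (simp add: pre_digraph.digraph_isomorphism_def flip: B'(3,4))
  then have "parcs B = (\<lambda>(u, v). (iso_verts h u, iso_verts h v)) ` parcs A"
    unfolding B' by (intro image_cong) auto
  with inj B'(1) show "\<exists>f. bij_betw f (pverts A) (pverts B)
      \<and> parcs B = (\<lambda>(u, v). (f u, f v)) ` parcs A"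
    unfolding bij_betw_def by blast
next
  interpret pair_wf_digraph A by (rule assms)
  assume "\<exists>f. bij_betw f (pverts A) (pverts B) \<and> parcs B = (\<lambda>(u, v). (f u, f v)) ` parcs A"
  then obtain f where f: "inj_on f (pverts A)" "f ` pverts A = pverts B"
      "parcs B = (\<lambda>(u, v). (f u, f v)) ` parcs A"
    by (auto simp: bij_betw_def)
  let ?h = "\<lparr>iso_verts = f, iso_arcs = (\<lambda>(u, v). (f u, f v)), iso_head = snd, iso_tail = fst\<rparr>"
  have "inj_on (\<lambda>(u, v). (f u, f v)) (parcs A)"
    using f(1) by (auto simp: inj_on_def dest: in_arcsD1 in_arcsD2)
  moreover have "wf_digraph (with_proj A)"
    by unfold_locales (auto dest: in_arcsD1 in_arcsD2)
  ultimately have "pre_digraph.digraph_isomorphism (with_proj A) ?h"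
    using f(1) by (auto simp: pre_digraph.digraph_isomorphism_def)
  moreover have "with_proj B = app_iso ?h (with_proj A)"
    using f by (simp add: with_proj_def app_iso_def)
  ultimately show "digraph_iso (with_proj A) (with_proj B)"
    unfolding digraph_iso_def by blast
qed

definition cos_digraph ::
  "('a, 'm) monoid_scheme \<Rightarrow> 'a set \<Rightarrow> 'a set \<Rightarrow> 'a set pair_pre_digraph" where
  "cos_digraph G K S =
    \<lparr> pverts = {g <#\<^bsub>G\<^esub> K | g. g \<in> carrier G},
      parcs = {(g <#\<^bsub>G\<^esub> K, (g \<otimes>\<^bsub>G\<^esub> s) <#\<^bsub>G\<^esub> K) | g s. g \<in> carrier G \<and> s \<in> S} \<rparr>"

definition cay_digraph :: "('a, 'm) monoid_scheme \<Rightarrow> 'a set \<Rightarrow> 'a pair_pre_digraph" where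
  "cay_digraph G S =
    \<lparr> pverts = carrier G, parcs = {(g, g \<otimes>\<^bsub>G\<^esub> s) | g s. g \<in> carrier G \<and> s \<in> S} \<rparr>"

definition wreath_digraph ::
  "'u pair_pre_digraph \<Rightarrow> 'v pair_pre_digraph \<Rightarrow> ('u \<times> 'v) pair_pre_digraph" where
  "wreath_digraph \<Gamma>\<^sub>1 \<Gamma>\<^sub>2 =
    \<lparr> pverts = pverts \<Gamma>\<^sub>1 \<times> pverts \<Gamma>\<^sub>2,
      parcs = {((u, v), (u, v')) | u v v'. u \<in> pverts \<Gamma>\<^sub>1 \<and> (v, v') \<in> parcs \<Gamma>\<^sub>2}
            \<union> {((u, v), (u', v')) | u u' v v'.
                (u, u') \<in> parcs \<Gamma>\<^sub>1 \<and> v \<in> pverts \<Gamma>\<^sub>2 \<and> v' \<in> pverts \<Gamma>\<^sub>2} \<rparr>"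

definition empty_digraph :: "nat \<Rightarrow> nat pair_pre_digraph" where
  "empty_digraph t = \<lparr> pverts = {..<t}, parcs = {} \<rparr>"

text \<open>The vertices of \<open>\<Gamma>\<close> below are taken from the type of the group elements. This
  is no restriction: if the Cayley digraph is isomorphic to the wreath product of \<open>\<Gamma>\<close> and
  \<open>empty_digraph t\<close> with \<open>t \<ge> 2\<close>, then \<open>\<Gamma>\<close> has at most as many vertices as \<open>G\<close> has elements,
  hence an isomorphic copy on a subset of \<open>carrier G\<close>.\<close>

definition reducible :: "('a, 'm) monoid_scheme \<Rightarrow> 'a pair_pre_digraph set" where
  "reducible G =
    {cay_digraph G S | S. S \<subseteq> carrier G \<and> \<one>\<^bsub>G\<^esub> \<notin> S \<and>
      (\<exists>(\<Gamma> :: 'a pair_pre_digraph) t. pair_wf_digraph \<Gamma> \<and> t \<ge> 2 \<and>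
        digraph_iso (with_proj (cay_digraph G S))
          (with_proj (wreath_digraph \<Gamma> (empty_digraph t))))}"

definition cos_U_pair :: "('a, 'm) monoid_scheme \<Rightarrow> 'a set \<Rightarrow> 'a set \<Rightarrow> bool" where
  "cos_U_pair G K S \<longleftrightarrow>
    subgroup K G \<and> K \<noteq> {\<one>\<^bsub>G\<^esub>} \<and> S \<subseteq> carrier G \<and> K \<inter> S = {} \<and>
    K <#>\<^bsub>G\<^esub> S <#>\<^bsub>G\<^esub> K = S \<and>
    (\<forall>L. subgroup L G \<and> L <#>\<^bsub>G\<^esub> S <#>\<^bsub>G\<^esub> L = S \<and> K \<subseteq> L \<longrightarrow> L = K)"

definition cos_U :: "('a, 'm) monoid_scheme \<Rightarrow> 'a set pair_pre_digraph set" where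
  "cos_U G = {cos_digraph G K S | K S. cos_U_pair G K S}"

text \<open>The map sends a digraph, not the pair \<open>(K, S)\<close> presenting it, to a Cayley digraph. The
  description below is meaningful only if the value does not depend on the presentation, so
  statements about \<open>gamma_U\<close> should include this independence.\<close>

definition gamma_U ::
  "('a, 'm) monoid_scheme \<Rightarrow> 'a set pair_pre_digraph \<Rightarrow> 'a pair_pre_digraph" where
  "gamma_U G \<Delta> =
    (THE \<Theta>. \<exists>K S. cos_U_pair G K S \<and> \<Delta> = cos_digraph G K S \<and> \<Theta> = cay_digraph G S)"

end

theory Submission
  imports Defs
begin

text \<open>Everything is governed by one subgroup, the two-sided stabilizer \<open>M\<close> of \<open>S\<close>: the elements
  \<open>g\<close> with \<open>g S = S = S g\<close>. A subgroup \<open>L\<close> satisfies \<open>L S L = S\<close> iff \<open>L \<subseteq> M\<close>, so \<open>M\<close> is the only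
  subgroup that is maximal with this property, and \<open>S\<close> alone determines the subgroup it is paired
  with (\<open>cos_U_pair_iff\<close>). As moreover \<open>M\<close> is disjoint from \<open>S\<close> as soon as \<open>S\<close> omits the identity,
  \<open>cos_U\<close> is indexed by the sets \<open>S\<close> without the identity whose \<open>M\<close> is nontrivial. The indexing
  is injective because a coset digraph remembers \<open>K\<close>, its vertex containing the identity, and
  then \<open>S\<close>, the union of the out-neighbours of \<open>K\<close> (\<open>cos_digraph_inject\<close>). A Cayley
  digraph remembers \<open>S\<close> as the out-neighbourhood of the identity.

  It remains to see that the reducible Cayley digraphs are exactly those with nontrivial \<open>M\<close>
  (\<open>reducible_eq\<close>). Two vertices \<open>g\<close>, \<open>h\<close> of the Cayley digraph have the same in- and
  out-neighbours iff \<open>g\<inverse> h \<in> M\<close>. In a wreath product with \<open>t \<ge> 2\<close> isolated vertices, two vertices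
  over the same point are such twins, so \<open>M\<close> is nontrivial. Conversely the
  left cosets of \<open>M\<close> are classes of mutual twins of equal size at least \<open>2\<close>; splitting all of them
  alike into \<open>t\<close> parts exhibits the digraph as a wreath product.\<close>

section \<open>Sets in bijection with several copies of a subset\<close>

text \<open>A set with at least two elements splits into \<open>t \<ge> 2\<close> copies of one of its subsets. A
  finite set consists of \<open>card K\<close> copies of a point; an infinite set is equipotent to two copies
  of itself. The second case is what lets infinite subgroups contribute to wreath products whose
  second factor has finitely many vertices.\<close>

lemma ex_bij_betw_Times_lessThan:
  assumes "a \<in> K" "K \<noteq> {a}"
  obtains A b t where "A \<subseteq> K" "2 \<le> t" "bij_betw b K (A \<times> {..<t::nat})"
proof (cases "finite K")
  case True
  then obtain e where e: "bij_betw e K {..<card K}"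
    using ex_bij_betw_finite_nat atLeast0LessThan by metis
  have "2 \<le> card K"
  proof (rule ccontr)
    assume "\<not> 2 \<le> card K"
    then have "card K \<le> Suc 0" by simp
    then show False using True assms by (auto simp: card_le_Suc0_iff_eq)
  qed
  moreover have "bij_betw (\<lambda>k. (a, e k)) K ({a} \<times> {..<card K})"
    using e by (auto simp: bij_betw_def inj_on_def)
  ultimately show ?thesis using that[of "{a}"] assms by blast
next
  case False
  have "|{..<2::nat}| \<le>o |K|"
    using False by (intro ordLess_imp_ordLeq finite_ordLess_infinite2) auto
  then have "|K \<times> {..<2::nat}| =o |K|"
    using card_of_Times_infinite[OF False, of "{..<2::nat}"] lessThan_empty_iff[of "2::nat"]
    by simp
  then obtain b where "bij_betw b K (K \<times> {..<2::nat})"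
    using card_of_ordIso ordIso_symmetric by blast
  then show ?thesis using that[of K 2] by blast
qed

section \<open>The two-sided stabilizer of a connection set\<close>

text \<open>In a group, for \<open>S\<close> a set of group elements, the condition on \<open>g\<close> says \<open>g S = S = S g\<close>; membership equivalences spare
  the passage between set products and elements.\<close>

definition (in monoid) two_sided_stabilizer :: "'a set \<Rightarrow> 'a set" where
  "two_sided_stabilizer S =
    {g \<in> carrier G. \<forall>x \<in> carrier G. (g \<otimes> x \<in> S \<longleftrightarrow> x \<in> S) \<and> (x \<otimes> g \<in> S \<longleftrightarrow> x \<in> S)}"

context group
begin

lemma subgroup_two_sided_stabilizer: "subgroup (two_sided_stabilizer S) G"
proof (rule subgroupI)
  show "two_sided_stabilizer S \<noteq> {}"
    unfolding two_sided_stabilizer_def by (auto intro!: exI[of _ \<one>])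
next
  fix g assume g: "g \<in> two_sided_stabilizer S"
  then have gG: "g \<in> carrier G" by (simp add: two_sided_stabilizer_def)
  have "inv g \<otimes> x \<in> S \<longleftrightarrow> x \<in> S" "x \<otimes> inv g \<in> S \<longleftrightarrow> x \<in> S" if "x \<in> carrier G" for x
  proof -
    have "g \<otimes> (inv g \<otimes> x) \<in> S \<longleftrightarrow> inv g \<otimes> x \<in> S" "(x \<otimes> inv g) \<otimes> g \<in> S \<longleftrightarrow> x \<otimes> inv g \<in> S"
      using g gG that by (simp_all add: two_sided_stabilizer_def)
    then show "inv g \<otimes> x \<in> S \<longleftrightarrow> x \<in> S" "x \<otimes> inv g \<in> S \<longleftrightarrow> x \<in> S"
      using gG that by (simp_all add: m_assoc flip: m_assoc[of g])
  qed
  then show "inv g \<in> two_sided_stabilizer S"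
    using gG by (simp add: two_sided_stabilizer_def)
next
  fix g h assume "g \<in> two_sided_stabilizer S" "h \<in> two_sided_stabilizer S"
  then show "g \<otimes> h \<in> two_sided_stabilizer S"
    by (simp add: two_sided_stabilizer_def m_assoc) (simp flip: m_assoc)
qed (auto simp: two_sided_stabilizer_def)

text \<open>If \<open>K S K = S\<close>, taking the identity as one of the factors gives \<open>K S \<subseteq> S\<close> and \<open>S K \<subseteq> S\<close>;
  the inverses in \<open>K\<close> turn these inclusions into equalities.\<close>

lemma subset_two_sided_stabilizer_iff:
  assumes K: "subgroup K G" and S: "S \<subseteq> carrier G"
  shows "K \<subseteq> two_sided_stabilizer S \<longleftrightarrow> K <#> S <#> K = S"
proof
  assume sub: "K \<subseteq> two_sided_stabilizer S"
  have "S \<subseteq> K <#> S <#> K"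
  proof
    fix s assume "s \<in> S"
    then have "\<one> \<otimes> s \<otimes> \<one> \<in> K <#> S <#> K"
      using subgroup.one_closed[OF K] unfolding set_mult_def by blast
    then show "s \<in> K <#> S <#> K" using \<open>s \<in> S\<close> S by auto
  qed
  moreover have "K <#> S <#> K \<subseteq> S"
    using sub S by (auto simp: set_mult_def two_sided_stabilizer_def subset_iff)
  ultimately show "K <#> S <#> K = S" by blast
next
  assume eq: "K <#> S <#> K = S"
  have mem: "k \<otimes> s \<otimes> l \<in> S" if "k \<in> K" "s \<in> S" "l \<in> K" for k s l
    using that eq unfolding set_mult_def by blast
  have left: "k \<otimes> s \<in> S" and right: "s \<otimes> k \<in> S" if "k \<in> K" "s \<in> S" for k s
    using mem[OF that subgroup.one_closed[OF K]] mem[OF subgroup.one_closed[OF K] that(2,1)]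
      that S subgroup.mem_carrier[OF K] by (simp_all add: subset_iff)
  show "K \<subseteq> two_sided_stabilizer S"
  proof
    fix k assume k: "k \<in> K"
    then have kG: "k \<in> carrier G" and ik: "inv k \<in> K"
      using subgroup.mem_carrier[OF K] subgroup.m_inv_closed[OF K] by auto
    have "x \<in> S" if "x \<in> carrier G" "k \<otimes> x \<in> S" for x
      using left[OF ik that(2)] that kG by (simp flip: m_assoc)
    moreover have "x \<in> S" if "x \<in> carrier G" "x \<otimes> k \<in> S" for x
      using right[OF ik that(2)] that kG by (simp add: m_assoc)
    ultimately show "k \<in> two_sided_stabilizer S"
      using left[OF k] right[OF k] kG unfolding two_sided_stabilizer_def by blast
  qed
qed

text \<open>An element \<open>s\<close> of both sets would give \<open>s \<in> S = s S\<close>, hence \<open>\<one> \<in> S\<close>.\<close>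

lemma two_sided_stabilizer_disjoint:
  assumes "S \<subseteq> carrier G" "\<one> \<notin> S"
  shows "two_sided_stabilizer S \<inter> S = {}"
proof -
  have False if "s \<in> S" "s \<in> two_sided_stabilizer S" for s
  proof -
    have "s \<otimes> \<one> \<in> S \<longleftrightarrow> \<one> \<in> S"
      using that(2) unfolding two_sided_stabilizer_def by blast
    then show False using that assms by auto
  qed
  then show ?thesis by blast
qed

text \<open>The subgroups \<open>L\<close> with \<open>L S L = S\<close> have a greatest element, so maximality of \<open>K\<close> leaves no
  choice. That \<open>S\<close> omits the identity is the trace of \<open>K \<inter> S = {}\<close>.\<close>

lemma cos_U_pair_iff:
  "cos_U_pair G K S \<longleftrightarrow>
    S \<subseteq> carrier G \<and> \<one> \<notin> S \<and> two_sided_stabilizer S \<noteq> {\<one>} \<and> K = two_sided_stabilizer S"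
  (is "_ \<longleftrightarrow> ?R")
proof
  let ?M = "two_sided_stabilizer S"
  assume pair: "cos_U_pair G K S"
  then have K: "subgroup K G" and S: "S \<subseteq> carrier G" and "K \<subseteq> ?M"
    using subset_two_sided_stabilizer_iff by (auto simp: cos_U_pair_def)
  moreover have "?M <#> S <#> ?M = S"
    using subset_two_sided_stabilizer_iff[OF subgroup_two_sided_stabilizer S] by blast
  moreover have "L = K" if "subgroup L G" "L <#> S <#> L = S" "K \<subseteq> L" for L
    using pair that by (simp add: cos_U_pair_def)
  ultimately have "K = ?M"
    using subgroup_two_sided_stabilizer[of S] by metis
  then show ?R
    using pair subgroup.one_closed[OF K] by (auto simp: cos_U_pair_def)
next
  let ?M = "two_sided_stabilizer S"
  assume R: ?R
  then have S: "S \<subseteq> carrier G" by blast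
  have "?M <#> S <#> ?M = S"
    using subset_two_sided_stabilizer_iff[OF subgroup_two_sided_stabilizer S] by blast
  moreover have "L = ?M" if "subgroup L G" "L <#> S <#> L = S" "?M \<subseteq> L" for L
    using subset_two_sided_stabilizer_iff[OF that(1) S] that(2,3) by blast
  ultimately show "cos_U_pair G K S"
    using R subgroup_two_sided_stabilizer[of S] two_sided_stabilizer_disjoint[of S]
    by (simp add: cos_U_pair_def)
qed

section \<open>Recovering the connection set from a Cayley or coset digraph\<close>

lemma parcs_cay_digraph_iff:
  assumes "S \<subseteq> carrier G"
  shows "(g, h) \<in> parcs (cay_digraph G S) \<longleftrightarrow>
    g \<in> carrier G \<and> h \<in> carrier G \<and> inv g \<otimes> h \<in> S"
proof
  assume "g \<in> carrier G \<and> h \<in> carrier G \<and> inv g \<otimes> h \<in> S"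
  then show "(g, h) \<in> parcs (cay_digraph G S)"
    by (auto simp: cay_digraph_def intro!: exI[of _ "inv g \<otimes> h"]) (simp flip: m_assoc)
qed (use assms in \<open>auto simp: cay_digraph_def simp flip: m_assoc\<close>)

lemma cay_digraph_inject:
  assumes "S \<subseteq> carrier G" "S' \<subseteq> carrier G" "cay_digraph G S = cay_digraph G S'"
  shows "S = S'"
proof -
  have "s \<in> S \<longleftrightarrow> s \<in> S'" if "s \<in> carrier G" for s
    using assms(3) parcs_cay_digraph_iff[OF assms(1), of \<one> s]
      parcs_cay_digraph_iff[OF assms(2), of \<one> s] that by simp
  then show ?thesis using assms(1,2) by blast
qed

lemma cos_U_pair_carrier: "cos_U_pair G K S \<Longrightarrow> S \<subseteq> carrier G"
  by (simp add: cos_U_pair_def)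

text \<open>The out-neighbours of the vertex \<open>K\<close> are the cosets \<open>k s K\<close>, and all of these lie in
  \<open>S\<close> because \<open>K S K = S\<close>.\<close>

lemma cos_digraph_connection_set:
  assumes K: "subgroup K G" and S: "S \<subseteq> carrier G" and stab: "K \<subseteq> two_sided_stabilizer S"
  shows "S = \<Union> (parcs (cos_digraph G K S) `` {K})"
proof (intro subset_antisym subsetI)
  fix s assume s: "s \<in> S"
  then have "(\<one> <# K, (\<one> \<otimes> s) <# K) \<in> parcs (cos_digraph G K S)"
    by (simp add: cos_digraph_def) blast
  then have "(K, s <# K) \<in> parcs (cos_digraph G K S)"
    using s S lcos_mult_one[OF subgroup.subset[OF K]] by (simp add: subset_iff)
  moreover have "s \<in> s <# K"
    using lcos_self s S K by blast
  ultimately show "s \<in> \<Union> (parcs (cos_digraph G K S) `` {K})" by blast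
next
  fix x assume "x \<in> \<Union> (parcs (cos_digraph G K S) `` {K})"
  then obtain g s where g: "g \<in> carrier G" "s \<in> S" "K = g <# K" and x: "x \<in> (g \<otimes> s) <# K"
    by (auto simp: cos_digraph_def)
  then have "g \<in> K" using lcos_self[OF _ K, of g] by blast
  then have "g \<otimes> s \<in> S" using stab g S by (auto simp: two_sided_stabilizer_def)
  moreover obtain k where "k \<in> K" "x = g \<otimes> s \<otimes> k" using x by (auto simp: l_coset_def)
  ultimately show "x \<in> S" using stab S by (auto simp: two_sided_stabilizer_def)
qed

text \<open>\<open>K\<close> is a vertex of the second digraph, that is, a coset of \<open>K'\<close>; as it contains the
  identity, it is \<open>K'\<close> itself.\<close>

lemma cos_digraph_inject:
  assumes "cos_U_pair G K S" "cos_U_pair G K' S'" and eq: "cos_digraph G K S = cos_digraph G K' S'"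
  shows "S = S'"
proof -
  have sub: "subgroup K G" "subgroup K' G"
    using assms by (simp_all add: cos_U_pair_def)
  have "K \<in> pverts (cos_digraph G K' S')"
    unfolding eq[symmetric] using lcos_mult_one[OF subgroup.subset[OF sub(1)]]
    by (auto simp: cos_digraph_def intro!: exI[of _ \<one>])
  then obtain g where g: "g \<in> carrier G" "K = g <# K'"
    by (auto simp: cos_digraph_def)
  then have "\<one> \<in> g <# K'" using subgroup.one_closed[OF sub(1)] by simp
  then have "g <# K' = \<one> <# K'"
    using l_repr_independence[of \<one> g K'] g sub by simp
  then have "K = K'" using g lcos_mult_one[OF subgroup.subset[OF sub(2)]] by simp
  with assms cos_digraph_connection_set show ?thesis
    by (metis cos_U_pair_iff order_refl sub)
qed

section \<open>Wreath decompositions and nontrivial stabilizers\<close>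

text \<open>Arcs of the wreath product depend on the first coordinates only, so the group elements \<open>g\<close>
  and \<open>h\<close> at \<open>(u, 0)\<close> and \<open>(u, 1)\<close> are twins, and \<open>g\<inverse> h\<close> is the required
  element of the stabilizer.\<close>

lemma two_sided_stabilizer_nontrivial_if_wreath:
  assumes S: "S \<subseteq> carrier G" and t: "t \<ge> 2"
    and iso: "digraph_iso (with_proj (cay_digraph G S))
        (with_proj (wreath_digraph \<Gamma> (empty_digraph t)))"
  shows "two_sided_stabilizer S \<noteq> {\<one>}"
proof -
  let ?C = "cay_digraph G S" and ?W = "wreath_digraph \<Gamma> (empty_digraph t)"
  have wf: "pair_wf_digraph ?C"
    using S by unfold_locales (auto simp: cay_digraph_def)
  obtain f where f: "bij_betw f (carrier G) (pverts \<Gamma> \<times> {..<t})"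
    and arcs: "parcs ?W = (\<lambda>(u, v). (f u, f v)) ` parcs ?C"
    using iso unfolding digraph_iso_with_proj_iff[OF wf]
    by (auto simp: wreath_digraph_def empty_digraph_def cay_digraph_def)
  have inj: "inj_on f (carrier G)" using f by (simp add: bij_betw_def)
  have arc_iff: "inv x \<otimes> y \<in> S \<longleftrightarrow> (fst (f x), fst (f y)) \<in> parcs \<Gamma>"
    if xy: "x \<in> carrier G" "y \<in> carrier G" for x y
  proof -
    have "f x \<in> pverts \<Gamma> \<times> {..<t}" "f y \<in> pverts \<Gamma> \<times> {..<t}"
      using xy f by (auto simp: bij_betw_def)
    then have "(f x, f y) \<in> parcs ?W \<longleftrightarrow> (fst (f x), fst (f y)) \<in> parcs \<Gamma>"
      by (cases "f x"; cases "f y") (auto simp: wreath_digraph_def empty_digraph_def)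
    moreover have "(f x, f y) \<in> parcs ?W \<longleftrightarrow> (x, y) \<in> parcs ?C"
    proof
      assume "(f x, f y) \<in> parcs ?W"
      then obtain x' y' where "(x', y') \<in> parcs ?C" "f x = f x'" "f y = f y'"
        unfolding arcs by auto
      moreover from this have "x' = x" "y' = y"
        using inj xy parcs_cay_digraph_iff[OF S] by (auto simp: inj_on_def)
      ultimately show "(x, y) \<in> parcs ?C" by simp
    next
      assume "(x, y) \<in> parcs ?C"
      then show "(f x, f y) \<in> parcs ?W"
        unfolding arcs by (intro image_eqI[where x = "(x, y)"]) auto
    qed
    ultimately show ?thesis using parcs_cay_digraph_iff[OF S] xy by blast
  qed
  define u where "u = fst (f \<one>)"
  have "f \<one> \<in> pverts \<Gamma> \<times> {..<t}" using f by (auto simp: bij_betw_def)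
  then have u: "u \<in> pverts \<Gamma>" by (auto simp: u_def)
  then have "(u, 0) \<in> f ` carrier G" "(u, 1) \<in> f ` carrier G"
    using f t by (auto simp: bij_betw_def)
  then obtain g h where g: "g \<in> carrier G" "f g = (u, 0)" and h: "h \<in> carrier G" "f h = (u, 1)"
    by (metis imageE)
  let ?k = "inv g \<otimes> h"
  have "?k \<noteq> \<one>"
  proof
    assume "?k = \<one>"
    then have "g = h" using g h by (metis inv_equality inv_inv inv_closed)
    then show False using g h by simp
  qed
  moreover have "?k \<in> two_sided_stabilizer S"
  proof -
    \<comment> \<open>\<open>f g\<close> and \<open>f h\<close> have the same first coordinate\<close>
    have out: "inv g \<otimes> y \<in> S \<longleftrightarrow> inv h \<otimes> y \<in> S"
      and into: "inv y \<otimes> g \<in> S \<longleftrightarrow> inv y \<otimes> h \<in> S" if "y \<in> carrier G" for y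
      using g h that by (simp_all add: arc_iff)
    have "?k \<otimes> x \<in> S \<longleftrightarrow> x \<in> S" "x \<otimes> ?k \<in> S \<longleftrightarrow> x \<in> S" if x: "x \<in> carrier G" for x
    proof -
      show "?k \<otimes> x \<in> S \<longleftrightarrow> x \<in> S"
        using out[of "h \<otimes> x"] g h x by (simp add: m_assoc flip: m_assoc[of "inv h"])
      show "x \<otimes> ?k \<in> S \<longleftrightarrow> x \<in> S"
        using into[of "g \<otimes> inv x"] g h x by (simp add: inv_mult_group m_assoc)
    qed
    then show ?thesis using g h by (simp add: two_sided_stabilizer_def)
  qed
  ultimately show ?thesis by blast
qed

text \<open>Write the stabilizer \<open>K\<close> as \<open>t\<close> copies of a subset \<open>A\<close>, via \<open>b : K \<rightarrow> A \<times> {..<t}\<close>, and choose a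
  representative \<open>r g\<close> in every coset \<open>g K\<close>. Sending \<open>g = r g k\<close> with \<open>b k = (a, i)\<close> to
  \<open>(r g a, i)\<close> moves the first coordinate only within \<open>g K\<close>, where all vertices are twins. So the
  Cayley digraph is the wreath product of its own induced subdigraph on the elements \<open>r g a\<close> with
  \<open>t\<close> isolated vertices. For finite \<open>K\<close> that subdigraph lives on a transversal of the cosets.\<close>

lemma wreath_if_two_sided_stabilizer_nontrivial:
  assumes S: "S \<subseteq> carrier G" and nontriv: "two_sided_stabilizer S \<noteq> {\<one>}"
  obtains \<Gamma> :: "'a pair_pre_digraph" and t
  where "pair_wf_digraph \<Gamma>" "t \<ge> 2"
    "digraph_iso (with_proj (cay_digraph G S))
        (with_proj (wreath_digraph \<Gamma> (empty_digraph t)))"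
proof -
  define K where "K = two_sided_stabilizer S"
  have K: "subgroup K G" unfolding K_def by (rule subgroup_two_sided_stabilizer)
  note KG = subgroup.mem_carrier[OF K]
  obtain A b t where A: "A \<subseteq> K" and t: "t \<ge> 2" and b: "bij_betw b K (A \<times> {..<t::nat})"
    using ex_bij_betw_Times_lessThan[of \<one> K] subgroup.one_closed[OF K] nontriv
    unfolding K_def by metis
  have bK: "fst (b k) \<in> A" "snd (b k) < t" if "k \<in> K" for k
    using bij_betw_apply[OF b that] by auto
  \<comment> \<open>The choice depends on the coset alone, so \<open>r\<close> is constant on cosets.\<close>
  define r where "r g = (SOME x. x \<in> g <# K)" for g
  have r: "r g \<in> g <# K" if "g \<in> carrier G" for g
    using lcos_self[OF that K] unfolding r_def by (rule someI)
  have rG: "r g \<in> carrier G" if "g \<in> carrier G" for g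
    using r[OF that] l_coset_subset_G[OF subgroup.subset[OF K] that] by blast
  have r_mult: "r (g \<otimes> k) = r g" if "g \<in> carrier G" "k \<in> K" for g k
  proof -
    have "g \<otimes> k \<in> g <# K" using that by (auto simp: l_coset_def)
    then have "g <# K = (g \<otimes> k) <# K" using l_repr_independence that K by blast
    then show ?thesis by (simp add: r_def)
  qed
  have r_ex: "\<exists>k\<in>K. r g = g \<otimes> k" if "g \<in> carrier G" for g
    using r[OF that] by (auto simp: l_coset_def)
  define c where "c g = inv (r g) \<otimes> g" for g
  have c: "c g \<in> K" if g: "g \<in> carrier G" for g
  proof -
    obtain k where "k \<in> K" "r g = g \<otimes> k" using r_ex[OF g] by blast
    then have "c g = inv k" using g KG by (simp add: c_def inv_mult_group m_assoc)
    then show ?thesis using subgroup.m_inv_closed[OF K \<open>k \<in> K\<close>] by simp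
  qed
  have rc: "r g \<otimes> c g = g" if "g \<in> carrier G" for g
    using rG[OF that] that by (simp add: c_def flip: m_assoc)
  have r_r: "r (r g) = r g" if "g \<in> carrier G" for g
    using r_ex[OF that] r_mult[OF that] by auto
  define p where "p g = r g \<otimes> fst (b (c g))" for g
  define V where "V = {r g \<otimes> a | g a. g \<in> carrier G \<and> a \<in> A}"
  define \<Gamma> where "\<Gamma> = \<lparr>pverts = V, parcs = parcs (cay_digraph G S) \<inter> V \<times> V\<rparr>"
  define f where "f g = (p g, snd (b (c g)))" for g
  have p_ex: "\<exists>k\<in>K. p g = g \<otimes> k" if g: "g \<in> carrier G" for g
  proof -
    obtain k where k: "k \<in> K" "r g = g \<otimes> k" using r_ex[OF g] by blast
    have a: "fst (b (c g)) \<in> K" using bK(1)[OF c[OF g]] A by blast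
    then have "p g = g \<otimes> (k \<otimes> fst (b (c g)))"
      using k g KG by (simp add: p_def m_assoc)
    then show ?thesis using subgroup.m_closed[OF K k(1) a] by blast
  qed
  have pV: "p g \<in> V" if "g \<in> carrier G" for g
    using bK(1)[OF c[OF that]] that by (auto simp: p_def V_def)
  have pG: "p g \<in> carrier G" if "g \<in> carrier G" for g
    using p_ex[OF that] that KG by auto
  have rp: "r (p g) = r g" if "g \<in> carrier G" for g
    using p_ex[OF that] r_mult[OF that] by auto
  have inj: "inj_on f (carrier G)"
  proof (rule inj_onI)
    fix g h assume gh: "g \<in> carrier G" "h \<in> carrier G" and "f g = f h"
    then have p: "p g = p h" and s: "snd (b (c g)) = snd (b (c h))" by (auto simp: f_def)
    have rr: "r g = r h" using rp[OF gh(1)] rp[OF gh(2)] p by simp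
    have "fst (b (c g)) \<in> carrier G" "fst (b (c h)) \<in> carrier G"
      using bK(1)[OF c] gh A KG by blast+
    then have "fst (b (c g)) = fst (b (c h))"
      using p rr rG[OF gh(2)] by (simp add: p_def)
    then have "b (c g) = b (c h)" using s by (simp add: prod_eq_iff)
    then have "c g = c h" using b c gh by (auto simp: bij_betw_def inj_on_def)
    then show "g = h" using rr rc gh by metis
  qed
  have "f ` carrier G = V \<times> {..<t}"
  proof (intro subset_antisym subsetI)
    fix w assume "w \<in> f ` carrier G"
    then show "w \<in> V \<times> {..<t}" using pV bK(2)[OF c] by (auto simp: f_def)
  next
    fix w assume "w \<in> V \<times> {..<t}"
    then obtain g a i where w: "w = (r g \<otimes> a, i)" "g \<in> carrier G" "a \<in> A" "i < t"
      by (auto simp: V_def)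
    then have "(a, i) \<in> b ` K" using b by (auto simp: bij_betw_def)
    then obtain k where k: "k \<in> K" "b k = (a, i)" by (metis imageE)
    let ?h = "r g \<otimes> k"
    have h: "?h \<in> carrier G" using rG KG w k by simp
    have rh: "r ?h = r g" using r_mult[OF rG] r_r w k by simp
    then have "c ?h = k" using rG[OF w(2)] KG[OF k(1)] by (simp add: c_def flip: m_assoc)
    then have "f ?h = w" using rh k w by (simp add: f_def p_def)
    then show "w \<in> f ` carrier G" using h by blast
  qed
  with inj have bij: "bij_betw f (carrier G) (V \<times> {..<t})" by (simp add: bij_betw_def)
  have arc_p: "inv (p x) \<otimes> p y \<in> S \<longleftrightarrow> inv x \<otimes> y \<in> S"
    if xy: "x \<in> carrier G" "y \<in> carrier G" for x y
  proof -
    obtain k l where k: "k \<in> K" "p x = x \<otimes> k" and l: "l \<in> K" "p y = y \<otimes> l"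
      using p_ex xy by blast
    have ik: "inv k \<in> K" using subgroup.m_inv_closed[OF K k(1)] .
    have eq: "inv (p x) \<otimes> p y = inv k \<otimes> (inv x \<otimes> y) \<otimes> l"
      using k l xy KG by (simp add: inv_mult_group m_assoc)
    have "inv k \<otimes> (inv x \<otimes> y) \<otimes> l \<in> S \<longleftrightarrow> inv k \<otimes> (inv x \<otimes> y) \<in> S"
      using l(1) xy KG[OF ik] unfolding K_def two_sided_stabilizer_def by simp
    also have "\<dots> \<longleftrightarrow> inv x \<otimes> y \<in> S"
      using ik xy unfolding K_def two_sided_stabilizer_def by simp
    finally show ?thesis using eq by simp
  qed
  have arc_f: "(f x, f y) \<in> parcs (wreath_digraph \<Gamma> (empty_digraph t)) \<longleftrightarrow>
      (x, y) \<in> parcs (cay_digraph G S)" if xy: "x \<in> carrier G" "y \<in> carrier G" for x y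
    using xy pV pG bK(2)[OF c] arc_p parcs_cay_digraph_iff[OF S]
    by (auto simp: wreath_digraph_def empty_digraph_def f_def \<Gamma>_def)
  have "parcs (wreath_digraph \<Gamma> (empty_digraph t)) =
      (\<lambda>(u, v). (f u, f v)) ` parcs (cay_digraph G S)"
  proof (intro subset_antisym subsetI)
    fix w assume w: "w \<in> parcs (wreath_digraph \<Gamma> (empty_digraph t))"
    then have "w \<in> f ` carrier G \<times> f ` carrier G"
      unfolding bij_betw_imp_surj_on[OF bij]
      by (auto simp: wreath_digraph_def empty_digraph_def \<Gamma>_def)
    then obtain x y where xy: "x \<in> carrier G" "y \<in> carrier G" "w = (f x, f y)"
      by blast
    then show "w \<in> (\<lambda>(u, v). (f u, f v)) ` parcs (cay_digraph G S)"
      using w arc_f by (intro image_eqI[where x = "(x, y)"]) auto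
  next
    fix w assume "w \<in> (\<lambda>(u, v). (f u, f v)) ` parcs (cay_digraph G S)"
    then show "w \<in> parcs (wreath_digraph \<Gamma> (empty_digraph t))"
      using arc_f parcs_cay_digraph_iff[OF S] by auto
  qed
  moreover have "pair_wf_digraph (cay_digraph G S)"
    using S by unfold_locales (auto simp: cay_digraph_def)
  ultimately have "digraph_iso (with_proj (cay_digraph G S))
      (with_proj (wreath_digraph \<Gamma> (empty_digraph t)))"
    using bij by (auto simp: digraph_iso_with_proj_iff cay_digraph_def wreath_digraph_def
        empty_digraph_def \<Gamma>_def)
  moreover have "pair_wf_digraph \<Gamma>"
    by unfold_locales (auto simp: \<Gamma>_def)
  ultimately show ?thesis using t that by blast
qed

section \<open>The bijection\<close>

lemma reducible_eq:
  "reducible G =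
    {cay_digraph G S | S. S \<subseteq> carrier G \<and> \<one> \<notin> S \<and> two_sided_stabilizer S \<noteq> {\<one>}}"
proof -
  have "(\<exists>(\<Gamma> :: 'a pair_pre_digraph) t. pair_wf_digraph \<Gamma> \<and> t \<ge> 2 \<and>
        digraph_iso (with_proj (cay_digraph G S))
          (with_proj (wreath_digraph \<Gamma> (empty_digraph t))))
      \<longleftrightarrow> two_sided_stabilizer S \<noteq> {\<one>}" if "S \<subseteq> carrier G" for S
    using two_sided_stabilizer_nontrivial_if_wreath[OF that]
      wreath_if_two_sided_stabilizer_nontrivial[OF that] by metis
  then show ?thesis by (simp add: reducible_def cong: conj_cong)
qed

lemma gamma_U_cos_digraph:
  assumes "cos_U_pair G K S"
  shows "gamma_U G (cos_digraph G K S) = cay_digraph G S"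
  unfolding gamma_U_def
proof (rule the_equality)
  show "\<exists>K' S'. cos_U_pair G K' S' \<and> cos_digraph G K S = cos_digraph G K' S' \<and>
      cay_digraph G S = cay_digraph G S'"
    using assms by blast
  fix \<Theta>
  assume "\<exists>K' S'. cos_U_pair G K' S' \<and> cos_digraph G K S = cos_digraph G K' S' \<and>
      \<Theta> = cay_digraph G S'"
  then show "\<Theta> = cay_digraph G S" using cos_digraph_inject[OF assms] by metis
qed

lemma bij_betw_gamma_U: "bij_betw (gamma_U G) (cos_U G) (reducible G)"
  unfolding bij_betw_def
proof
  show "inj_on (gamma_U G) (cos_U G)"
  proof (rule inj_onI)
    fix \<Delta> \<Delta>' assume "\<Delta> \<in> cos_U G" "\<Delta>' \<in> cos_U G" and eq: "gamma_U G \<Delta> = gamma_U G \<Delta>'"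
    then obtain K S K' S' where KS: "cos_U_pair G K S" "\<Delta> = cos_digraph G K S"
      and KS': "cos_U_pair G K' S'" "\<Delta>' = cos_digraph G K' S'"
      unfolding cos_U_def by blast
    then have "cay_digraph G S = cay_digraph G S'"
      using eq by (simp add: gamma_U_cos_digraph)
    then have "S = S'" using KS(1) KS'(1) by (intro cay_digraph_inject cos_U_pair_carrier)
    then show "\<Delta> = \<Delta>'" using KS KS' by (simp add: cos_U_pair_iff)
  qed
  have "gamma_U G ` cos_U G = {cay_digraph G S | S. \<exists>K. cos_U_pair G K S}"
    unfolding cos_U_def by (force simp: gamma_U_cos_digraph)
  then show "gamma_U G ` cos_U G = reducible G"
    by (simp add: reducible_eq cos_U_pair_iff)
qed

end

theorem corollary4p5:
  fixes G :: "('a, 'm) monoid_scheme"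
  assumes "group G"
  shows "(\<forall>K S. cos_U_pair G K S \<longrightarrow> gamma_U G (cos_digraph G K S) = cay_digraph G S)
    \<and> bij_betw (gamma_U G) (cos_U G) (reducible G)"
  using group.gamma_U_cos_digraph[OF assms] group.bij_betw_gamma_U[OF assms] by blast

end
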